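(* Let $\mathbb{F}$ be a field of characteristic $p>2$, let $\chi\in\mathfrak{sl}(2)^*$ with $\chi(e)=0$, and let $\lambda\in\Lambda_\chi$. Then $$\mathrm{H}^1(\mathfrak{sl}(2), L_{\chi}(\lambda))=\begin{cases}\mathbb{F}d_{1}+\mathbb{F}d_{2}, & (\chi,\lambda)=(0,p-2),\\ 0, & \text{otherwise},\end{cases}$$ where $d_1$ and $d_2$ (standing for their classes in $\mathrm{H}^1$) are the linear maps from $\mathfrak{sl}(2)$ to $L_{0}(p-2)$ such that $$d_{1}(h)=d_{1}(f)=0,\quad d_{1}(e)=v_{p-2},\qquad d_{2}(h)=d_{2}(e)=0,\quad d_{2}(f)=v_{0}.$$
   Context: The underlying field $\mathbb{F}$ has characteristic $p>2$, and $\mathbb{F}_p\subseteq\mathbb{F}$ is its prime field. $\mathfrak{sl}(2)$ is the 3-dimensional simple Lie algebra over $\mathbb{F}$ of trace-zero $2\times 2$ matrices, with standard basis $h=\mathrm{diag}(1,-1)$, $e=E_{12}$, $f=E_{21}$. It is a restricted Lie algebra with $h^{[p]}=h$, $e^{[p]}=f^{[p]}=0$. Derivations: for a finite-dimensional Lie algebra $\mathfrak{g}$ and a finite-dimensional $\mathfrak{g}$-module $M$, a derivation of $\mathfrak{g}$ on $M$ is a linear map $\phi:\mathfrak{g}\to M$ with $\phi([x,y])=x\phi(y)-y\phi(x)$ for all $x,y\in\mathfrak{g}$; $\mathrm{Der}(\mathfrak{g},M)$ is the space of these. For $m\in M$ the inner derivation $D_m$ is $D_m(x)=xm$; $\mathrm{Ider}(\mathfrak{g},M)$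 is the space of inner derivations. $\mathrm{H}^1(\mathfrak{g},M)=\mathrm{Der}(\mathfrak{g},M)/\mathrm{Ider}(\mathfrak{g},M)$. Modules: let $\chi\in\mathfrak{sl}(2)^*$ with $\chi(e)=0$. $U_\chi(\mathfrak{sl}(2))$ is the quotient of the universal enveloping algebra of $\mathfrak{sl}(2)$ by the two-sided ideal generated by all $x^p-x^{[p]}-\chi(x)^p$, $x\in\mathfrak{sl}(2)$; $U_\chi$ of a restricted subalgebra is defined likewise. Put $\Lambda_\chi=\{\lambda\in\mathbb{F}\mid \lambda^p-\lambda=\chi(h)^p\}$. For $\lambda\in\Lambda_\chi$, let $\mathbb{F}v$ be the 1-dimensional $U_\chi(\mathbb{F}h+\mathbb{F}e)$-module with $hv=\lambda v$, $ev=0$, and let $Z_\chi(\lambda)=U_\chi(\mathfrak{sl}(2))\otimes_{U_\chi(\mathbb{F}h+\mathbb{F}e)}\mathbb{F}v$, with basis $v_i=f^i\otimes v$, $0\le i\le p-1$. $L_\chi(\lambda)$ denotes the unique simple quotient of $Z_\chi(\lambda)$ (images of the $v_i$ are denoted by the same symbols). Explicitly: (1) If $\chi(h)\ne0$ or $\chi(f)\neq 0$, $L_\chi(\lambda)$ has basis $v_0,\dots,v_{p-1}$ with $ev_i=i(\lambda-i+1)v_{i-1}$, $hv_i=(\lambda-2i)v_i$, $fv_i=v_{i+1}$ for $i<p-1$, and $fv_{p-1}=\chi(f)^pv_0$. (2) If $\chi=0$ (so $\lambda\in\mathbb{F}_p$), let $\Phi(\lambda)\in\{0,1,\dots,p-1\}$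 be the integer congruent to $\lambda$ mod $p$; $L_0(\lambda)$ has basis $v_0,\dots,v_{\Phi(\lambda)}$ with $ev_i=i(\lambda-i+1)v_{i-1}$, $hv_i=(\lambda-2i)v_i$, $fv_i=v_{i+1}$ for $i<\Phi(\lambda)$, and $fv_{\Phi(\lambda)}=0$. Integers such as $p-2$ are viewed in $\mathbb{F}_p\subseteq\mathbb{F}$ when used as values of $\lambda$. *)

theory Defs
  imports "HOL-Analysis.Analysis" "HOL-Library.Function_Algebras"
begin

section \<open>The Lie algebra sl(2)\<close>

typedef (overloaded) 'a sl2 = "{A :: 'a::comm_ring_1 ^ 2 ^ 2. trace A = 0}"
  morphisms mat_of of_mat
  by (rule exI[of _ 0]) (simp add: trace_def)

setup_lifting type_definition_sl2

instantiation sl2 :: (comm_ring_1) ab_group_add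
begin

lift_definition zero_sl2 :: "'a sl2" is 0 by (simp add: trace_def)
lift_definition plus_sl2 :: "'a sl2 \<Rightarrow> 'a sl2 \<Rightarrow> 'a sl2" is "(+)" by (simp add: trace_add)
lift_definition minus_sl2 :: "'a sl2 \<Rightarrow> 'a sl2 \<Rightarrow> 'a sl2" is "(-)" by (simp add: trace_sub)
lift_definition uminus_sl2 :: "'a sl2 \<Rightarrow> 'a sl2" is uminus
  by (simp add: trace_def sum_negf)

instance
  by standard (transfer; simp add: algebra_simps)+

end

lift_definition sl2_scale :: "'a::comm_ring_1 \<Rightarrow> 'a sl2 \<Rightarrow> 'a sl2"
  is "\<lambda>c A. \<chi> i j. c * A $ i $ j"
  by (simp add: trace_def sum_2 flip: distrib_left)

lift_definition sl2_bracket :: "'a::comm_ring_1 sl2 \<Rightarrow> 'a sl2 \<Rightarrow> 'a sl2"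
  is "\<lambda>A B. A ** B - B ** A"
  by (metis trace_sub trace_mul_sym diff_self)

lift_definition sl2_h :: "'a::comm_ring_1 sl2" is "vector [vector [1, 0], vector [0, -1]]"
  by (simp add: trace_def sum_2)

lift_definition sl2_e :: "'a::comm_ring_1 sl2" is "vector [vector [0, 1], vector [0, 0]]"
  by (simp add: trace_def sum_2)

lift_definition sl2_f :: "'a::comm_ring_1 sl2" is "vector [vector [0, 0], vector [1, 0]]"
  by (simp add: trace_def sum_2)

lemma mat_of_22: "mat_of x $ 2 $ 2 = - mat_of x $ 1 $ 1"
  using mat_of[of x] by (simp add: trace_def sum_2 add_eq_0_iff)

lemma sl2_eqI:
  assumes "mat_of x $ 1 $ 1 = mat_of y $ 1 $ 1"
    and "mat_of x $ 1 $ 2 = mat_of y $ 1 $ 2"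
    and "mat_of x $ 2 $ 1 = mat_of y $ 2 $ 1"
  shows "x = y"
proof -
  have "mat_of x = mat_of y"
    using assms unfolding vec_eq_iff forall_2 by (simp add: mat_of_22)
  then show ?thesis by (simp add: mat_of_inject)
qed

lemma mat_of_simps [simp]:
  "mat_of 0 = 0" "mat_of (x + y) = mat_of x + mat_of y"
  "mat_of (sl2_scale c x) $ i $ j = c * mat_of x $ i $ j"
  "mat_of sl2_h $ 1 $ 1 = 1" "mat_of sl2_h $ 1 $ 2 = 0" "mat_of sl2_h $ 2 $ 1 = 0"
  "mat_of sl2_e $ 1 $ 1 = 0" "mat_of sl2_e $ 1 $ 2 = 1" "mat_of sl2_e $ 2 $ 1 = 0"
  "mat_of sl2_f $ 1 $ 1 = 0" "mat_of sl2_f $ 1 $ 2 = 0" "mat_of sl2_f $ 2 $ 1 = 1"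
  by (simp_all add: zero_sl2.rep_eq plus_sl2.rep_eq sl2_scale.rep_eq sl2_h.rep_eq
      sl2_e.rep_eq sl2_f.rep_eq)

lemma mat_of_bracket:
  "mat_of (sl2_bracket x y) $ 1 $ 1 = mat_of x $ 1 $ 2 * mat_of y $ 2 $ 1 - mat_of x $ 2 $ 1 * mat_of y $ 1 $ 2"
  "mat_of (sl2_bracket x y) $ 1 $ 2 = 2 * (mat_of x $ 1 $ 1 * mat_of y $ 1 $ 2 - mat_of x $ 1 $ 2 * mat_of y $ 1 $ 1)"
  "mat_of (sl2_bracket x y) $ 2 $ 1 = 2 * (mat_of x $ 2 $ 1 * mat_of y $ 1 $ 1 - mat_of x $ 1 $ 1 * mat_of y $ 2 $ 1)"
  by (simp_all add: sl2_bracket.rep_eq matrix_matrix_mult_def sum_2 mat_of_22 algebra_simps)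

lemma sl2_decomp:
  "x = sl2_scale (mat_of x $ 1 $ 1) sl2_h + sl2_scale (mat_of x $ 1 $ 2) sl2_e
       + sl2_scale (mat_of x $ 2 $ 1) sl2_f"
  by (rule sl2_eqI) simp_all

lemma sl2_brackets:
  "sl2_bracket sl2_h sl2_e = sl2_scale 2 (sl2_e :: 'a::comm_ring_1 sl2)"
  "sl2_bracket sl2_h sl2_f = sl2_scale (-2) (sl2_f :: 'a::comm_ring_1 sl2)"
  "sl2_bracket sl2_e sl2_f = (sl2_h :: 'a::comm_ring_1 sl2)"
  by (rule sl2_eqI; simp add: mat_of_bracket)+

lemma vector_space_sl2: "vector_space (sl2_scale :: 'a::field \<Rightarrow> _)"
  by standard (rule sl2_eqI; simp add: algebra_simps)+


section \<open>Modules and first cohomology\<close>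

text \<open>A finite-dimensional module is a subspace \<open>V\<close> of some vector space with scalar
  multiplication \<open>sc\<close>, together with an action of sl(2) on \<open>V\<close>.\<close>

definition sl2_module ::
  "('a::field \<Rightarrow> 'm::ab_group_add \<Rightarrow> 'm) \<Rightarrow> 'm set \<Rightarrow> ('a sl2 \<Rightarrow> 'm \<Rightarrow> 'm) \<Rightarrow> bool" where
  "sl2_module sc V act \<longleftrightarrow>
     vector_space sc \<and> module.subspace sc V \<and>
     (\<exists>B. finite B \<and> V = module.span sc B) \<and>
     (\<forall>x. \<forall>m\<in>V. act x m \<in> V) \<and>
     (\<forall>x. \<forall>m\<in>V. \<forall>n\<in>V. act x (m + n) = act x m + act x n) \<and>
     (\<forall>x c. \<forall>m\<in>V. act x (sc c m) = sc c (act x m)) \<and>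
     (\<forall>x y. \<forall>m\<in>V. act (x + y) m = act x m + act y m) \<and>
     (\<forall>c x. \<forall>m\<in>V. act (sl2_scale c x) m = sc c (act x m)) \<and>
     (\<forall>x y. \<forall>m\<in>V. act (sl2_bracket x y) m = act x (act y m) - act y (act x m))"

definition simple_sl2_module ::
  "('a::field \<Rightarrow> 'm::ab_group_add \<Rightarrow> 'm) \<Rightarrow> 'm set \<Rightarrow> ('a sl2 \<Rightarrow> 'm \<Rightarrow> 'm) \<Rightarrow> bool" where
  "simple_sl2_module sc V act \<longleftrightarrow>
     sl2_module sc V act \<and> V \<noteq> {0} \<and>
     (\<forall>W. module.subspace sc W \<and> W \<subseteq> V \<and> (\<forall>x. \<forall>m\<in>W. act x m \<in> W) \<longrightarrow> W = {0} \<or> W = V)"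

definition Der ::
  "('a::field \<Rightarrow> 'm::ab_group_add \<Rightarrow> 'm) \<Rightarrow> 'm set \<Rightarrow> ('a sl2 \<Rightarrow> 'm \<Rightarrow> 'm) \<Rightarrow> ('a sl2 \<Rightarrow> 'm) set" where
  "Der sc V act =
     {\<phi>. Vector_Spaces.linear sl2_scale sc \<phi> \<and> range \<phi> \<subseteq> V \<and>
         (\<forall>x y. \<phi> (sl2_bracket x y) = act x (\<phi> y) - act y (\<phi> x))}"

definition inner_der :: "('a::field sl2 \<Rightarrow> 'm \<Rightarrow> 'm) \<Rightarrow> 'm \<Rightarrow> 'a sl2 \<Rightarrow> 'm" where
  "inner_der act m = (\<lambda>x. act x m)"

definition Ider :: "'m set \<Rightarrow> ('a::field sl2 \<Rightarrow> 'm \<Rightarrow> 'm) \<Rightarrow> ('a sl2 \<Rightarrow> 'm) set" where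
  "Ider V act = inner_der act ` V"

text \<open>The class of \<open>\<phi>\<close> is the coset \<open>\<phi> + Ider V act\<close>; \<open>H1\<close> is the quotient space
  \<open>Der / Ider\<close>, realised as the set of these cosets.\<close>

definition H1_class ::
  "'m::ab_group_add set \<Rightarrow> ('a::field sl2 \<Rightarrow> 'm \<Rightarrow> 'm) \<Rightarrow> ('a sl2 \<Rightarrow> 'm) \<Rightarrow> ('a sl2 \<Rightarrow> 'm) set" where
  "H1_class V act \<phi> = {\<phi> + \<delta> | \<delta>. \<delta> \<in> Ider V act}"

definition H1 ::
  "('a::field \<Rightarrow> 'm::ab_group_add \<Rightarrow> 'm) \<Rightarrow> 'm set \<Rightarrow> ('a sl2 \<Rightarrow> 'm \<Rightarrow> 'm) \<Rightarrow> ('a sl2 \<Rightarrow> 'm) set set" where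
  "H1 sc V act = H1_class V act ` Der sc V act"


section \<open>The modules L\<open>\<^sub>\<chi>\<close>(\<open>\<lambda>\<close>)\<close>

definition Lambda :: "('a::field sl2 \<Rightarrow> 'a) \<Rightarrow> 'a set" where
  "Lambda X = {l. l ^ CHAR('a) - l = X sl2_h ^ CHAR('a)}"

definition Phi :: "'a::field \<Rightarrow> nat" where
  "Phi l = (THE n. n < CHAR('a) \<and> of_nat n = l)"

definition L_dim :: "('a::field sl2 \<Rightarrow> 'a) \<Rightarrow> 'a \<Rightarrow> nat" where
  "L_dim X l = (if X sl2_h \<noteq> 0 \<or> X sl2_f \<noteq> 0 then CHAR('a) else Phi l + 1)"

text \<open>Vectors are coordinate sequences with respect to \<open>v\<^sub>0, v\<^sub>1, \<dots>\<close>, vanishing from index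
  \<open>L_dim\<close> on.\<close>

definition L_scale :: "'a::field \<Rightarrow> (nat \<Rightarrow> 'a) \<Rightarrow> nat \<Rightarrow> 'a" where
  "L_scale c m = (\<lambda>i. c * m i)"

definition L_space :: "('a::field sl2 \<Rightarrow> 'a) \<Rightarrow> 'a \<Rightarrow> (nat \<Rightarrow> 'a) set" where
  "L_space X l = {m. \<forall>i \<ge> L_dim X l. m i = 0}"

definition L_basis :: "nat \<Rightarrow> nat \<Rightarrow> 'a::field" where
  "L_basis i = (\<lambda>j. if j = i then 1 else 0)"

definition e_basis :: "'a::field \<Rightarrow> nat \<Rightarrow> nat \<Rightarrow> 'a" where
  "e_basis l i = L_scale (of_nat i * (l - of_nat i + 1)) (L_basis (i - 1))"

definition h_basis :: "'a::field \<Rightarrow> nat \<Rightarrow> nat \<Rightarrow> 'a" where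
  "h_basis l i = L_scale (l - 2 * of_nat i) (L_basis i)"

definition f_basis :: "('a::field sl2 \<Rightarrow> 'a) \<Rightarrow> 'a \<Rightarrow> nat \<Rightarrow> nat \<Rightarrow> 'a" where
  "f_basis X l i =
     (if i + 1 < L_dim X l then L_basis (i + 1)
      else if X sl2_h \<noteq> 0 \<or> X sl2_f \<noteq> 0 then L_scale (X sl2_f ^ CHAR('a)) (L_basis 0)
      else 0)"

text \<open>The entries \<open>x\<^sub>1\<^sub>1\<close>, \<open>x\<^sub>1\<^sub>2\<close>, \<open>x\<^sub>2\<^sub>1\<close> are the coordinates of \<open>x\<close> with respect to \<open>h, e, f\<close>
  (lemma \<open>sl2_decomp\<close>).\<close>

definition L_act :: "('a::field sl2 \<Rightarrow> 'a) \<Rightarrow> 'a \<Rightarrow> 'a sl2 \<Rightarrow> (nat \<Rightarrow> 'a) \<Rightarrow> nat \<Rightarrow> 'a" where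
  "L_act X l x m =
     (\<Sum>i<L_dim X l. L_scale (m i)
        (L_scale (mat_of x $ 1 $ 1) (h_basis l i)
         + L_scale (mat_of x $ 1 $ 2) (e_basis l i)
         + L_scale (mat_of x $ 2 $ 1) (f_basis X l i)))"

definition d1 :: "'a::field sl2 \<Rightarrow> nat \<Rightarrow> 'a" where
  "d1 x = L_scale (mat_of x $ 1 $ 2) (L_basis (CHAR('a) - 2))"

definition d2 :: "'a::field sl2 \<Rightarrow> nat \<Rightarrow> 'a" where
  "d2 x = L_scale (mat_of x $ 2 $ 1) (L_basis 0)"

lemma vector_space_L_scale: "vector_space (L_scale :: 'a::field \<Rightarrow> _)"
  by standard (auto simp: L_scale_def fun_eq_iff algebra_simps)

lemma d1_char:
  "Vector_Spaces.linear sl2_scale L_scale (d1 :: 'a::field sl2 \<Rightarrow> _)"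
  "d1 (sl2_h :: 'a sl2) = 0" "d1 (sl2_f :: 'a sl2) = 0"
  "d1 (sl2_e :: 'a sl2) = L_basis (CHAR('a) - 2)"
proof -
  show "Vector_Spaces.linear sl2_scale L_scale (d1 :: 'a sl2 \<Rightarrow> _)"
    by (simp add: Vector_Spaces.linear_iff vector_space_sl2 vector_space_L_scale
        d1_def L_scale_def fun_eq_iff algebra_simps)
qed (simp_all add: d1_def L_scale_def fun_eq_iff)

lemma d2_char:
  "Vector_Spaces.linear sl2_scale L_scale (d2 :: 'a::field sl2 \<Rightarrow> _)"
  "d2 (sl2_h :: 'a sl2) = 0" "d2 (sl2_e :: 'a sl2) = 0"
  "d2 (sl2_f :: 'a sl2) = L_basis 0"
proof -
  show "Vector_Spaces.linear sl2_scale L_scale (d2 :: 'a sl2 \<Rightarrow> _)"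
    by (simp add: Vector_Spaces.linear_iff vector_space_sl2 vector_space_L_scale
        d2_def L_scale_def fun_eq_iff algebra_simps)
qed (simp_all add: d2_def L_scale_def fun_eq_iff)


section \<open>L\<open>\<^sub>\<chi>\<close>(\<open>\<lambda>\<close>) is a simple quotient of the baby Verma module\<close>

text \<open>The \<open>U\<^sub>\<chi>\<close>-module \<open>Z\<^sub>\<chi>(\<lambda>)\<close> is the universal \<open>\<chi>\<close>-reduced module generated by a vector
  \<open>v\<^sub>0\<close> with \<open>h v\<^sub>0 = \<lambda> v\<^sub>0\<close> and \<open>e v\<^sub>0 = 0\<close>. The results below confirm that the explicit module
  above is a simple module generated by such a vector, on which \<open>x\<^sup>p - x\<^bsup>[p]\<^esup> - \<chi>(x)\<^sup>p\<close> vanishes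
  for \<open>x = e, h, f\<close>; as \<open>x\<^sup>p - x\<^bsup>[p]\<^esup>\<close> is \<open>p\<close>-semilinear in \<open>x\<close>, it vanishes for all \<open>x\<close>.\<close>

lemma of_nat_power_CHAR:
  assumes "prime CHAR('a::comm_semiring_1)"
  shows "(of_nat n :: 'a) ^ CHAR('a) = of_nat n"
proof -
  have "(\<Sum>i<n. (1::'a)) ^ CHAR('a) = (\<Sum>i<n. 1 ^ CHAR('a))"
    by (rule freshmans_dream_sum) (use assms in auto)
  then show ?thesis by simp
qed

lemma of_nat_inj_CHAR:
  assumes "of_nat i = (of_nat j :: 'a::field)" "i < CHAR('a)" "j < CHAR('a)"
  shows "i = j"
proof -
  have *: "a = b" if "a \<le> b" "b < CHAR('a)" "of_nat a = (of_nat b :: 'a)" for a b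
  proof -
    have "of_nat (b - a) = (of_nat b - of_nat a :: 'a)" using that(1) by (rule of_nat_diff)
    then have "CHAR('a) dvd b - a" unfolding of_nat_eq_0_iff_char_dvd[symmetric] using that(3) by simp
    then have "b - a = 0" using that(2) by (metis dvd_imp_le less_imp_diff_less not_gr_zero not_less)
    then show ?thesis using that(1) by simp
  qed
  show ?thesis
  proof (cases "i \<le> j")
    case True then show ?thesis using *[of i j] assms by blast
  next
    case False then show ?thesis using *[of j i] assms by (metis nat_le_linear)
  qed
qed

lemma prime_field_exists:
  fixes l :: "'a::field"
  assumes p: "prime CHAR('a)" and l: "l ^ CHAR('a) = l"
  shows "\<exists>n. n < CHAR('a) \<and> of_nat n = l"
proof (rule ccontr)
  assume no: "\<not> ?thesis"
  let ?q = "Polynomial.monom 1 CHAR('a) - [:0, 1::'a:]"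
  let ?S = "insert l (of_nat ` {..<CHAR('a)})"
  have p1: "CHAR('a) > 1" using p prime_gt_1_nat by blast
  have "Polynomial.coeff ?q CHAR('a) = 1" using p1 by (simp add: coeff_pCons split: nat.split)
  then have q0: "?q \<noteq> 0" by (metis coeff_0 zero_neq_one)
  have deg: "degree ?q \<le> CHAR('a)" using p1
    by (intro degree_diff_le) (auto simp: degree_monom_le)
  have sub: "?S \<subseteq> {x. poly ?q x = 0}"
    using l of_nat_power_CHAR[OF p] by (auto simp: poly_monom)
  have "card ?S \<le> card {x. poly ?q x = 0}"
    using poly_roots_finite[OF q0] sub by (rule card_mono)
  also have "\<dots> \<le> degree ?q" by (rule card_poly_roots_bound[OF q0])
  finally have "card ?S \<le> CHAR('a)" using deg by simp
  moreover have "card ?S = Suc (card (of_nat ` {..<CHAR('a)} :: 'a set))"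
    using no by (subst card_insert_disjoint) auto
  moreover have "card (of_nat ` {..<CHAR('a)} :: 'a set) = CHAR('a)"
    by (subst card_image) (auto intro: inj_onI of_nat_inj_CHAR)
  ultimately show False by simp
qed

lemma Phi:
  fixes l :: "'a::field"
  assumes "prime CHAR('a)" and "l ^ CHAR('a) = l"
  shows "Phi l < CHAR('a)" and "of_nat (Phi l) = l"
proof -
  have "\<exists>!n. n < CHAR('a) \<and> of_nat n = l"
    using prime_field_exists[OF assms] of_nat_inj_CHAR by metis
  from theI'[OF this] show "Phi l < CHAR('a)" and "of_nat (Phi l) = l"
    by (auto simp: Phi_def)
qed

lemma sum_fun_eval: "(\<Sum>i\<in>A. F i) j = (\<Sum>i\<in>A. F i j)" for F :: "'i \<Rightarrow> 'j \<Rightarrow> 'b::comm_monoid_add"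
  by (induction A rule: infinite_finite_induct) auto

text \<open>The coefficient of \<open>v\<^sub>0\<close> in \<open>f v\<^bsub>n-1\<^esub>\<close>, where \<open>n = L_dim X l\<close>.\<close>

definition L_wrap :: "('a::field sl2 \<Rightarrow> 'a) \<Rightarrow> 'a" where
  "L_wrap X = (if X sl2_h \<noteq> 0 \<or> X sl2_f \<noteq> 0 then X sl2_f ^ CHAR('a) else 0)"

lemma L_scale_apply: "L_scale c m i = c * m i"
  by (simp add: L_scale_def)

lemma L_dim_pos: "CHAR('a) > 2 \<Longrightarrow> L_dim X (l::'a::field) > 0"
  by (simp add: L_dim_def)

lemma L_act_coord:
  fixes l :: "'a::field"
  assumes p: "CHAR('a) > 2" and m: "m \<in> L_space X l"
  shows "L_act X l x m j =
    (if j < L_dim X l then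
       mat_of x $ 1 $ 1 * (l - 2 * of_nat j) * m j
       + mat_of x $ 1 $ 2 * (of_nat (j + 1) * (l - of_nat j)) * m (j + 1)
       + mat_of x $ 2 $ 1 * (if j = 0 then L_wrap X * m (L_dim X l - 1) else m (j - 1))
     else 0)"
proof -
  let ?n = "L_dim X l"
  have n0: "?n > 0" by (rule L_dim_pos[OF p])
  have mz: "m i = 0" if "i \<ge> ?n" for i using m that by (simp add: L_space_def)
  have H: "(\<Sum>i<?n. m i * (a * h_basis l i j)) =
      (if j < ?n then a * (l - 2 * of_nat j) * m j else 0)" for a
    by (simp add: h_basis_def L_scale_def L_basis_def if_distrib sum.delta cong: if_cong)
  have E: "(\<Sum>i<?n. m i * (b * e_basis l i j)) =
      (if j < ?n then b * (of_nat (j + 1) * (l - of_nat j)) * m (j + 1) else 0)" for b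
  proof -
    have "(\<Sum>i<?n. m i * (b * e_basis l i j)) =
       (\<Sum>i<?n. if i = j + 1 then b * (of_nat (j + 1) * (l - of_nat j)) * m (j + 1) else 0)"
    proof (rule sum.cong)
      fix i
      show "m i * (b * e_basis l i j) =
          (if i = j + 1 then b * (of_nat (j + 1) * (l - of_nat j)) * m (j + 1) else 0)"
        by (cases i) (auto simp: e_basis_def L_scale_def L_basis_def)
    qed simp
    also have "\<dots> = (if j + 1 < ?n then b * (of_nat (j + 1) * (l - of_nat j)) * m (j + 1) else 0)"
      by (simp add: sum.delta)
    finally show ?thesis using mz[of "j + 1"] by (auto simp: not_less)
  qed
  have F: "(\<Sum>i<?n. m i * (c * f_basis X l i j)) =
      (if j < ?n then c * (if j = 0 then L_wrap X * m (?n - 1) else m (j - 1)) else 0)" for c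
  proof -
    have "(\<Sum>i<?n. m i * (c * f_basis X l i j)) =
       (\<Sum>i<?n. (if i = j - 1 then (if 0 < j \<and> j < ?n then c * m (j - 1) else 0) else 0)
         + (if i = ?n - 1 then (if j = 0 then c * (L_wrap X * m (?n - 1)) else 0) else 0))"
      by (rule sum.cong) (auto simp: f_basis_def L_scale_def L_basis_def L_wrap_def)
    also have "\<dots> = (if j < ?n then c * (if j = 0 then L_wrap X * m (?n - 1) else m (j - 1)) else 0)"
      using n0 by (auto simp: sum.distrib sum.delta)
    finally show ?thesis .
  qed
  have "L_act X l x m j =
     (\<Sum>i<?n. m i * (mat_of x $ 1 $ 1 * h_basis l i j))
     + (\<Sum>i<?n. m i * (mat_of x $ 1 $ 2 * e_basis l i j))
     + (\<Sum>i<?n. m i * (mat_of x $ 2 $ 1 * f_basis X l i j))"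
    by (simp add: L_act_def sum_fun_eval L_scale_def sum.distrib distrib_left)
  then show ?thesis unfolding H E F by simp
qed

lemma L_act_space: "CHAR('a) > 2 \<Longrightarrow> m \<in> L_space X l \<Longrightarrow> L_act X l x m \<in> L_space X (l::'a::field)"
  using L_act_coord[of m X l x] unfolding L_space_def[of X l] by fastforce

lemma L_basis_in_space: "i < L_dim X l \<Longrightarrow> L_basis i \<in> L_space X l"
  by (simp add: L_space_def L_basis_def)

lemma L_space_span: "L_space X (l::'a::field) = module.span L_scale (L_basis ` {..<L_dim X l})"
proof -
  interpret vector_space "L_scale :: 'a \<Rightarrow> (nat \<Rightarrow> 'a) \<Rightarrow> _" by (rule vector_space_L_scale)
  show ?thesis
  proof
    show "span (L_basis ` {..<L_dim X l}) \<subseteq> L_space X l"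
      by (rule span_minimal)
        (auto simp: subspace_def L_basis_in_space, auto simp: L_space_def L_scale_def)
    show "L_space X l \<subseteq> span (L_basis ` {..<L_dim X l})"
    proof
      fix m assume m: "m \<in> L_space X l"
      have "m = (\<Sum>i<L_dim X l. L_scale (m i) (L_basis i))"
        using m by (auto simp: fun_eq_iff sum_fun_eval L_scale_def L_basis_def L_space_def
            if_distrib sum.delta cong: if_cong)
      also have "\<dots> \<in> span (L_basis ` {..<L_dim X l})"
        by (intro span_sum span_scale span_base) auto
      finally show "m \<in> span (L_basis ` {..<L_dim X l})" .
    qed
  qed
qed

lemma L_subspace: "module.subspace L_scale (L_space X (l::'a::field))"
proof -
  interpret vector_space "L_scale :: 'a \<Rightarrow> (nat \<Rightarrow> 'a) \<Rightarrow> _" by (rule vector_space_L_scale)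
  show ?thesis by (simp add: L_space_span)
qed

lemma L_cases:
  fixes l :: "'a::field"
  assumes p: "CHAR('a) > 2" and l: "l \<in> Lambda X"
  obtains (big) "L_dim X l = CHAR('a)" "L_wrap X = X sl2_f ^ CHAR('a)" "X sl2_h \<noteq> 0 \<or> X sl2_f \<noteq> 0"
  | (small) "L_wrap X = 0" "l = of_nat (L_dim X l - 1)" "L_dim X l \<le> CHAR('a)"
      "X sl2_h = 0" "X sl2_f = 0"
proof (cases "X sl2_h \<noteq> 0 \<or> X sl2_f \<noteq> 0")
  case True
  then show ?thesis using big by (simp add: L_dim_def L_wrap_def)
next
  case False
  have "prime CHAR('a)" using p by (intro prime_CHAR_semidom) auto
  moreover have "l ^ CHAR('a) = l" using l False p by (auto simp: Lambda_def power_0_left)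
  ultimately have "Phi l < CHAR('a)" "of_nat (Phi l) = l" by (rule Phi)+
  with False show ?thesis using small by (simp add: L_dim_def L_wrap_def)
qed

lemma L_dim_le:
  assumes "CHAR('a::field) > 2" and "(l::'a) \<in> Lambda X"
  shows "L_dim X l \<le> CHAR('a)"
proof (rule L_cases[OF assms])
  assume "L_dim X l = CHAR('a)" then show ?thesis by (rule eq_imp_le)
qed

lemma L_dim_relations:
  fixes l :: "'a::field"
  assumes p: "CHAR('a) > 2" and l: "l \<in> Lambda X"
  shows "of_nat (L_dim X l) * (l - of_nat (L_dim X l) + 1) = 0"
    and "L_wrap X * of_nat (L_dim X l) = 0"
proof -
  have "of_nat (L_dim X l) * (l - of_nat (L_dim X l) + 1) = 0 \<and> L_wrap X * of_nat (L_dim X l) = 0"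
  proof (rule L_cases[OF p l])
    assume "L_dim X l = CHAR('a)" then show ?thesis by simp
  next
    assume w: "L_wrap X = 0" and e: "l = of_nat (L_dim X l - 1)"
    have "of_nat (L_dim X l) = (of_nat (L_dim X l - 1) + 1 :: 'a)"
      using L_dim_pos[OF p, of X l] by (metis One_nat_def Suc_pred of_nat_Suc add.commute)
    then show ?thesis using w e by (metis add_diff_cancel_left' diff_add_cancel diff_add_eq mult_zero_left mult_zero_right diff_self)
  qed
  then show "of_nat (L_dim X l) * (l - of_nat (L_dim X l) + 1) = 0"
    and "L_wrap X * of_nat (L_dim X l) = 0" by blast+
qed

lemma L_act_bracket:
  fixes l :: "'a::field"
  assumes p: "CHAR('a) > 2" and l: "l \<in> Lambda X" and m: "m \<in> L_space X l"
  shows "L_act X l (sl2_bracket x y) m = L_act X l x (L_act X l y m) - L_act X l y (L_act X l x m)"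
proof
  fix j
  let ?n = "L_dim X l"
  have n0: "?n > 0" by (rule L_dim_pos[OF p])
  note C = L_act_coord[OF p]
  note S = L_act_space[OF p m]
  have mz: "m i = 0" if "i \<ge> ?n" for i using m that by (simp add: L_space_def)
  have r1: "of_nat ?n * (l - of_nat ?n + 1) = (0::'a)" by (rule L_dim_relations(1)[OF p l])
  have r2: "L_wrap X * of_nat ?n = 0" by (rule L_dim_relations(2)[OF p l])
  obtain a b c where x: "mat_of x $ 1 $ 1 = a" "mat_of x $ 1 $ 2 = b" "mat_of x $ 2 $ 1 = c" by blast
  obtain a' b' c' where y: "mat_of y $ 1 $ 1 = a'" "mat_of y $ 1 $ 2 = b'" "mat_of y $ 2 $ 1 = c'" by blast
  note simps = C m S mat_of_bracket x y
  consider "j \<ge> ?n" | "?n = 1" "j = 0" | k where "?n = Suc (Suc k)" "j = 0"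
    | k where "j = Suc k" "j + 1 < ?n" | k where "j = Suc k" "?n = Suc (Suc k)"
  proof (cases j)
    case 0
    then show ?thesis using that n0 by (metis One_nat_def gr0_conv_Suc old.nat.exhaust)
  next
    case (Suc k)
    have "j \<ge> ?n \<or> j + 1 < ?n \<or> ?n = Suc (Suc k)" using Suc by linarith
    then show ?thesis using that Suc by blast
  qed
  then show "L_act X l (sl2_bracket x y) m j =
      (L_act X l x (L_act X l y m) - L_act X l y (L_act X l x m)) j"
  proof cases
    case 1 then show ?thesis by (simp add: simps)
  next
    case 2
    then have "L_wrap X = 0" "l = 0" using r1 r2 by auto
    then have "L_act X l z q 0 = 0" if "q \<in> L_space X l" for z q
      using that 2(1) C[OF that, of z 0] by (simp add: L_space_def)
    then show ?thesis using 2(2) m S by simp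
  next
    case (3 k)
    have "L_wrap X = 0 \<or> 2 + of_nat k = (0::'a)"
      using r2 by (simp add: 3)
    then have r3: "L_wrap X = 0 \<or> of_nat k = (- 2 :: 'a)" by (auto simp: eq_neg_iff_add_eq_0 add.commute)
    have "L_act X l (sl2_bracket x y) m 0 =
        (L_act X l x (L_act X l y m) - L_act X l y (L_act X l x m)) 0"
      using r3 by (elim disjE; simp add: simps 3(1); simp add: algebra_simps)
    then show ?thesis by (simp only: 3(2))
  next
    case (4 k)
    have "L_act X l (sl2_bracket x y) m (Suc k) =
        (L_act X l x (L_act X l y m) - L_act X l y (L_act X l x m)) (Suc k)"
      using 4(2)[unfolded 4(1)] by (cases k; simp add: simps; simp add: algebra_simps)
    then show ?thesis by (simp only: 4(1))
  next
    case (5 k)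
    have mk: "m (Suc (Suc k)) = 0" using mz 5(2) by simp
    have "2 + of_nat k = (0::'a) \<or> l - (2 + of_nat k) + 1 = 0" using r1 by (simp add: 5(2))
    then have r3: "of_nat k = (-2::'a) \<or> l = 1 + of_nat k"
      by (auto simp: algebra_simps eq_neg_iff_add_eq_0)
    have "L_act X l (sl2_bracket x y) m (Suc k) =
        (L_act X l x (L_act X l y m) - L_act X l y (L_act X l x m)) (Suc k)"
      using r3
    proof
      assume k: "of_nat k = (-2::'a)"
      show ?thesis
      proof (cases k)
        case 0
        then show ?thesis using k by (simp add: simps 5(2) mk; simp add: algebra_simps)
      next
        case (Suc k')
        have "of_nat k' + 1 = (- 2 :: 'a)" using k by (simp add: Suc add.commute)
        then have "of_nat k' = (- 2 - 1 :: 'a)" by (simp only: eq_diff_eq)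
        also have "(- 2 - 1 :: 'a) = - 3" by simp
        finally have "of_nat k' = (- 3 :: 'a)" .
        then show ?thesis by (simp add: simps 5(2) mk Suc; simp add: algebra_simps)
      qed
    next
      assume l1: "l = 1 + of_nat k"
      show ?thesis by (cases k; simp add: simps 5(2) mk; simp add: l1 algebra_simps)
    qed
    then show ?thesis by (simp only: 5(1))
  qed
qed

lemma L_is_module:
  fixes l :: "'a::field"
  assumes p: "CHAR('a) > 2" and l: "l \<in> Lambda X"
  shows "sl2_module L_scale (L_space X l) (L_act X l)"
proof -
  note C = L_act_coord[OF p]
  have add: "m + m' \<in> L_space X l" if "m \<in> L_space X l" "m' \<in> L_space X l" for m m'
    using that by (simp add: L_space_def)
  have sc: "L_scale c m \<in> L_space X l" if "m \<in> L_space X l" for m c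
    using that by (simp add: L_space_def L_scale_def)
  have "\<exists>B. finite B \<and> L_space X l = module.span L_scale B"
    by (rule exI[of _ "L_basis ` {..<L_dim X l}"]) (simp add: L_space_span)
  moreover have "L_act X l x (m + m') = L_act X l x m + L_act X l x m'"
    if "m \<in> L_space X l" "m' \<in> L_space X l" for x m m'
    by (rule ext) (simp add: that add C algebra_simps)
  moreover have "L_act X l x (L_scale c m) = L_scale c (L_act X l x m)"
    if "m \<in> L_space X l" for x c m
    by (rule ext) (simp add: that sc C L_scale_apply algebra_simps)
  moreover have "L_act X l (x + y) m = L_act X l x m + L_act X l y m"
    if "m \<in> L_space X l" for x y m
    by (rule ext) (simp add: that C algebra_simps)
  moreover have "L_act X l (sl2_scale c x) m = L_scale c (L_act X l x m)"
    if "m \<in> L_space X l" for x c m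
    by (rule ext) (simp add: that C L_scale_apply algebra_simps)
  ultimately show ?thesis
    unfolding sl2_module_def
    by (simp add: vector_space_L_scale L_subspace L_act_space[OF p] L_act_bracket[OF p l])
qed

text \<open>\<open>v\<^sub>0\<close> is a highest weight vector and \<open>v\<^sub>i = f\<^sup>i v\<^sub>0\<close>.\<close>

lemma L_highest_weight:
  fixes l :: "'a::field"
  assumes p: "CHAR('a) > 2"
  shows "L_act X l sl2_e (L_basis 0) = 0"
    and "L_act X l sl2_h (L_basis 0) = L_scale l (L_basis 0)"
    and "i < L_dim X l \<Longrightarrow> (L_act X l sl2_f ^^ i) (L_basis 0) = L_basis i"
proof -
  note C = L_act_coord[OF p]
  have B0: "L_basis 0 \<in> L_space X l" by (rule L_basis_in_space[OF L_dim_pos[OF p]])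
  show "L_act X l sl2_e (L_basis 0) = 0"
    by (rule ext) (simp add: C B0, simp add: L_basis_def)
  show "L_act X l sl2_h (L_basis 0) = L_scale l (L_basis 0)"
    by (rule ext) (use L_dim_pos[OF p, of X l] in \<open>simp add: C B0 L_scale_apply, simp add: L_basis_def\<close>)
  show "(L_act X l sl2_f ^^ i) (L_basis 0) = L_basis i" if "i < L_dim X l"
    using that
  proof (induction i)
    case (Suc i)
    have Bi: "L_basis i \<in> L_space X l" using Suc.prems by (intro L_basis_in_space) simp
    have "L_act X l sl2_f (L_basis i) = L_basis (Suc i)"
      by (rule ext) (use Suc.prems in \<open>simp add: C Bi, auto simp add: L_basis_def\<close>)
    then show ?case using Suc by simp
  qed simp
qed

lemma L_e_power:
  fixes l :: "'a::field"
  assumes p: "CHAR('a) > 2" and l: "l \<in> Lambda X" and m: "m \<in> L_space X l"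
  shows "(L_act X l sl2_e ^^ CHAR('a)) m = 0"
proof -
  note C = L_act_coord[OF p]
  have "(L_act X l sl2_e ^^ k) m \<in> L_space X l \<and>
      (\<forall>i. L_dim X l \<le> i + k \<longrightarrow> (L_act X l sl2_e ^^ k) m i = 0)" for k
    by (induction k) (use m in \<open>auto simp: L_act_space[OF p] C, auto simp: L_space_def\<close>)
  from this[of "CHAR('a)"] show ?thesis
    using L_dim_le[OF p l] by (auto simp: fun_eq_iff)
qed

lemma L_h_power:
  fixes l :: "'a::field"
  assumes p: "CHAR('a) > 2" and l: "l \<in> Lambda X" and m: "m \<in> L_space X l"
  shows "(L_act X l sl2_h ^^ CHAR('a)) m - L_act X l sl2_h m = L_scale (X sl2_h ^ CHAR('a)) m"
proof
  fix j
  note C = L_act_coord[OF p]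
  have pr: "prime CHAR('a)" using p by (intro prime_CHAR_semidom) auto
  have *: "(L_act X l sl2_h ^^ k) m \<in> L_space X l \<and>
      (\<forall>i. (L_act X l sl2_h ^^ k) m i = (l - 2 * of_nat i) ^ k * m i)" for k
    by (induction k) (use m in \<open>auto simp: L_act_space[OF p] C, auto simp: L_space_def\<close>)
  have "l ^ CHAR('a) = (l - of_nat (2 * j) + of_nat (2 * j)) ^ CHAR('a)" by simp
  also have "\<dots> = (l - of_nat (2 * j)) ^ CHAR('a) + of_nat (2 * j) ^ CHAR('a)"
    by (rule freshmans_dream) (use pr in auto)
  also have "(of_nat (2 * j) :: 'a) ^ CHAR('a) = of_nat (2 * j)" by (rule of_nat_power_CHAR[OF pr])
  finally have "(l - 2 * of_nat j) ^ CHAR('a) - (l - 2 * of_nat j) = X sl2_h ^ CHAR('a)"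
    using l by (simp add: Lambda_def algebra_simps)
  then have "((l - 2 * of_nat j) ^ CHAR('a) - (l - 2 * of_nat j)) * m j = X sl2_h ^ CHAR('a) * m j"
    by simp
  then show "((L_act X l sl2_h ^^ CHAR('a)) m - L_act X l sl2_h m) j = L_scale (X sl2_h ^ CHAR('a)) m j"
    using * *[of 1] by (simp add: L_scale_apply left_diff_distrib)
qed

lemma L_f_power:
  fixes l :: "'a::field"
  assumes p: "CHAR('a) > 2" and l: "l \<in> Lambda X" and m: "m \<in> L_space X l"
  shows "(L_act X l sl2_f ^^ CHAR('a)) m = L_scale (X sl2_f ^ CHAR('a)) m"
proof -
  note C = L_act_coord[OF p]
  let ?n = "L_dim X l"
  have *: "k \<le> ?n \<Longrightarrow> (L_act X l sl2_f ^^ k) m \<in> L_space X l \<and>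
      (\<forall>i<?n. (L_act X l sl2_f ^^ k) m i = (if k \<le> i then m (i - k) else L_wrap X * m (?n + i - k)))" for k
  proof (induction k)
    case (Suc k)
    then have IH: "(L_act X l sl2_f ^^ k) m \<in> L_space X l"
      "i < ?n \<Longrightarrow> (L_act X l sl2_f ^^ k) m i = (if k \<le> i then m (i - k) else L_wrap X * m (?n + i - k))" for i
      by auto
    have "L_act X l sl2_f ((L_act X l sl2_f ^^ k) m) i =
        (if Suc k \<le> i then m (i - Suc k) else L_wrap X * m (?n + i - Suc k))" if i: "i < ?n" for i
    proof (cases i)
      case 0
      then show ?thesis using Suc.prems i IH(2)[of "?n - 1"] by (simp add: C IH(1))
    next
      case (Suc i')
      then show ?thesis using i IH(2)[of i'] by (simp add: C IH(1))
    qed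
    then show ?case using L_act_space[OF p IH(1)] by simp
  qed (use m in simp)
  have n: "(L_act X l sl2_f ^^ ?n) m = L_scale (L_wrap X) m"
  proof
    fix i
    show "(L_act X l sl2_f ^^ ?n) m i = L_scale (L_wrap X) m i"
      using *[of ?n] m by (cases "i < ?n") (auto simp: L_scale_apply L_space_def)
  qed
  show ?thesis
  proof (rule L_cases[OF p l])
    assume "?n = CHAR('a)" "L_wrap X = X sl2_f ^ CHAR('a)"
    then show ?thesis using n by simp
  next
    assume w: "L_wrap X = 0" "?n \<le> CHAR('a)" "X sl2_f = 0"
    have z: "L_act X l sl2_f 0 = 0"
      by (rule ext) (simp add: C L_space_def)
    have "(L_act X l sl2_f ^^ k) 0 = 0" for k by (induction k) (simp_all only: funpow.simps comp_apply id_apply z)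
    moreover have "(L_act X l sl2_f ^^ ?n) m = 0"
      using n w(1) by (simp add: L_scale_def fun_eq_iff)
    moreover have "CHAR('a) = (CHAR('a) - ?n) + ?n" using w(2) by simp
    ultimately have "(L_act X l sl2_f ^^ CHAR('a)) m = 0"
      by (metis funpow_add comp_apply)
    then show ?thesis using w(3) p by (simp add: L_scale_def fun_eq_iff power_0_left)
  qed
qed

lemma L_act_basis:
  fixes l :: "'a::field"
  assumes p: "CHAR('a) > 2" and i: "i < L_dim X l"
  shows "L_act X l sl2_h (L_basis i) = h_basis l i"
    and "L_act X l sl2_e (L_basis i) = e_basis l i"
    and "L_act X l sl2_f (L_basis i) = f_basis X l i"
proof -
  have "L_act X l x (L_basis i) =
      L_scale (mat_of x $ 1 $ 1) (h_basis l i) + L_scale (mat_of x $ 1 $ 2) (e_basis l i)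
      + L_scale (mat_of x $ 2 $ 1) (f_basis X l i)" for x
  proof
    fix j
    have "L_act X l x (L_basis i) j = (\<Sum>k<L_dim X l. if k = i then
        (L_scale (mat_of x $ 1 $ 1) (h_basis l i) + L_scale (mat_of x $ 1 $ 2) (e_basis l i)
          + L_scale (mat_of x $ 2 $ 1) (f_basis X l i)) j else 0)"
      unfolding L_act_def sum_fun_eval
      by (rule sum.cong) (auto simp: L_basis_def L_scale_apply)
    then show "L_act X l x (L_basis i) j =
       (L_scale (mat_of x $ 1 $ 1) (h_basis l i) + L_scale (mat_of x $ 1 $ 2) (e_basis l i)
          + L_scale (mat_of x $ 2 $ 1) (f_basis X l i)) j"
      using i by (simp add: sum.delta)
  qed
  then show "L_act X l sl2_h (L_basis i) = h_basis l i"
    and "L_act X l sl2_e (L_basis i) = e_basis l i"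
    and "L_act X l sl2_f (L_basis i) = f_basis X l i"
    by (simp_all add: fun_eq_iff L_scale_apply)
qed

lemma L_is_simple:
  fixes l :: "'a::field"
  assumes p: "CHAR('a) > 2" and l: "l \<in> Lambda X"
  shows "simple_sl2_module L_scale (L_space X l) (L_act X l)"
  unfolding simple_sl2_module_def
proof (intro conjI allI impI)
  interpret vector_space "L_scale :: 'a \<Rightarrow> (nat \<Rightarrow> 'a) \<Rightarrow> _" by (rule vector_space_L_scale)
  note C = L_act_coord[OF p]
  let ?n = "L_dim X l"
  have n0: "?n > 0" by (rule L_dim_pos[OF p])
  have np: "?n \<le> CHAR('a)" by (rule L_dim_le[OF p l])
  have pr: "prime CHAR('a)" using p by (intro prime_CHAR_semidom) auto
  show "sl2_module L_scale (L_space X l) (L_act X l)" by (rule L_is_module[OF p l])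
  show "L_space X l \<noteq> {0}"
  proof
    assume "L_space X l = {0}"
    then have "L_basis 0 = (0 :: nat \<Rightarrow> 'a)" using L_basis_in_space[OF n0] by auto
    then have "L_basis 0 (0::nat) = (0 :: 'a)" by (metis zero_fun_apply)
    then show False by (simp add: L_basis_def)
  qed
  fix W assume "subspace W \<and> W \<subseteq> L_space X l \<and> (\<forall>x. \<forall>m\<in>W. L_act X l x m \<in> W)"
  then have W: "subspace W" "W \<subseteq> L_space X l" "\<And>x m. m \<in> W \<Longrightarrow> L_act X l x m \<in> W" by auto
  have scW: "L_basis i \<in> W" if "L_scale c (L_basis i) \<in> W" "c \<noteq> 0" for i c
  proof -
    have "L_scale (inverse c) (L_scale c (L_basis i)) \<in> W"
      using W(1) that(1) by (rule subspace_scale)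
    then show ?thesis using that(2) by simp
  qed
  let ?supp = "\<lambda>m :: nat \<Rightarrow> 'a. {i. m i \<noteq> 0}"
  show "W = {0} \<or> W = L_space X l"
  proof (cases "W = {0}")
    case False
    then obtain m0 where "m0 \<in> W \<and> m0 \<noteq> 0" using subspace_0[OF W(1)] by blast
    then obtain m where m: "m \<in> W \<and> m \<noteq> 0"
      and min: "\<And>m'. m' \<in> W \<and> m' \<noteq> 0 \<Longrightarrow> card (?supp m) \<le> card (?supp m')"
      using ex_has_least_nat[of "\<lambda>m. m \<in> W \<and> m \<noteq> 0" m0 "\<lambda>m. card (?supp m)"] by blast
    have mL: "m \<in> L_space X l" using m W(2) by blast
    obtain i where i: "m i \<noteq> 0" using m by (auto simp: fun_eq_iff)
    have bnd: "k < ?n" if "m k \<noteq> 0" for k using mL that by (auto simp: L_space_def not_less[symmetric])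
    have "m j = 0" if "j \<noteq> i" for j
    proof (rule ccontr)
      assume j: "m j \<noteq> 0"
      define m' where "m' = L_act X l sl2_h m - L_scale (l - 2 * of_nat i) m"
      have m'W: "m' \<in> W" unfolding m'_def
        using m W by (intro subspace_diff subspace_scale) auto
      have m'k: "m' k = 2 * (of_nat i - of_nat k) * m k" for k
        using bnd[of k] by (cases "m k = 0") (auto simp: m'_def C mL L_scale_apply algebra_simps)
      have ij: "of_nat i - of_nat j \<noteq> (0::'a)"
        using of_nat_inj_CHAR[of i j, where 'a = 'a] bnd[OF i] bnd[OF j] np that by auto
      have "of_nat 2 \<noteq> (0::'a)" unfolding of_nat_eq_0_iff_char_dvd
        using p by (auto dest: dvd_imp_le)
      then have "m' j \<noteq> 0" using ij j by (simp add: m'k)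
      then have "m' \<noteq> 0" by (auto simp: fun_eq_iff)
      then have "card (?supp m) \<le> card (?supp m')" using min m'W by blast
      moreover have "?supp m' \<subset> ?supp m" using i by (auto simp: m'k)
      moreover have "finite (?supp m)"
        by (rule finite_subset[of _ "{..<?n}"]) (use bnd in auto)
      ultimately show False using psubset_card_mono by (metis not_less)
    qed
    then have "m = L_scale (m i) (L_basis i)"
      by (auto simp: fun_eq_iff L_scale_apply L_basis_def)
    then have vi: "L_basis i \<in> W" using scW[of "m i" i] m i by metis
    have i_n: "i < ?n" using bnd[OF i] .
    have up: "L_basis (Suc k) \<in> W" if "L_basis k \<in> W" "Suc k < ?n" for k
    proof -
      have "L_act X l sl2_f (L_basis k) = L_basis (Suc k)"
        using that(2) by (simp add: L_act_basis(3)[OF p] f_basis_def)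
      then show ?thesis using W(3)[OF that(1), of sl2_f] by simp
    qed
    have up': "L_basis k \<in> W" if "L_basis j \<in> W" "j \<le> k" "k < ?n" for j k
      using that(2) that(3,1) by (induction k rule: dec_induct) (auto intro: up)
    have v0: "L_basis 0 \<in> W"
    proof (cases "L_wrap X = 0")
      case False
      have "L_basis (?n - 1) \<in> W" using up'[OF vi, of "?n - 1"] i_n by simp
      then have "L_act X l sl2_f (L_basis (?n - 1)) \<in> W" by (rule W(3))
      moreover have "L_act X l sl2_f (L_basis (?n - 1)) = L_scale (L_wrap X) (L_basis 0)"
        using n0 False by (subst L_act_basis(3)[OF p]) (auto simp: f_basis_def L_wrap_def)
      ultimately show ?thesis using scW False by metis
    next
      case True
      have nz: "of_nat (Suc k) * (l - of_nat (Suc k) + 1) \<noteq> 0" if k: "Suc k < ?n" for k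
      proof -
        have "of_nat (Suc k) \<noteq> (0::'a)" unfolding of_nat_eq_0_iff_char_dvd
          using k np by (auto dest: dvd_imp_le)
        moreover have "l \<noteq> of_nat k"
        proof (rule L_cases[OF p l])
          assume "X sl2_h \<noteq> 0 \<or> X sl2_f \<noteq> 0" "L_wrap X = X sl2_f ^ CHAR('a)"
          then have "X sl2_h \<noteq> 0" using True by simp
          then show ?thesis using l of_nat_power_CHAR[OF pr, of k] by (auto simp: Lambda_def)
        next
          assume ln: "l = of_nat (?n - 1)"
          show ?thesis
          proof
            assume "l = of_nat k"
            then have "of_nat (?n - 1) = (of_nat k :: 'a)" using ln by metis
            then have "?n - 1 = k" by (rule of_nat_inj_CHAR) (use k np in auto)
            then show False using k by simp
          qed
        qed
        ultimately show ?thesis by (simp del: of_nat_Suc) (simp add: of_nat_Suc)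
      qed
      have down: "L_basis k \<in> W" if "L_basis (Suc k) \<in> W" "Suc k < ?n" for k
      proof -
        have "L_act X l sl2_e (L_basis (Suc k))
            = L_scale (of_nat (Suc k) * (l - of_nat (Suc k) + 1)) (L_basis k)"
          using that(2) by (simp only: L_act_basis(2)[OF p] e_basis_def diff_Suc_1)
        then show ?thesis using scW[OF _ nz[OF that(2)]] W(3)[OF that(1), of sl2_e] by metis
      qed
      have "k < ?n \<Longrightarrow> L_basis k \<in> W \<Longrightarrow> L_basis 0 \<in> W" for k
        by (induction k) (auto intro: down)
      then show ?thesis using vi i_n by blast
    qed
    have "L_space X l \<subseteq> W"
      unfolding L_space_span by (rule span_minimal) (use up'[OF v0] W(1) in auto)
    then show ?thesis using W(2) by blast
  qed simp
qed

end

theory Submission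
  imports Defs
begin

text \<open>A derivation is determined by its values at \<open>h, e, f\<close>, and subtracting an inner derivation
  normalises it. If \<open>\<chi>(f) \<noteq> 0\<close>, then \<open>f\<close> is bijective and one can achieve \<open>\<phi>(f) = 0\<close>; the cocycle
  relations then force \<open>\<phi> = 0\<close>. If \<open>h\<close> is bijective, one can achieve \<open>\<phi>(h) = 0\<close>, so that \<open>\<phi>(e)\<close> and
  \<open>\<phi>(f)\<close> are weight vectors of weight \<open>2\<close> and \<open>-2\<close>. This settles \<open>\<chi>(h) \<noteq> 0\<close>, where no weight lies
  in the prime field, and \<open>(\<chi>, \<lambda>) = (0, p - 2)\<close>, where the weight vectors are multiples of
  \<open>v\<^bsub>p-2\<^esub>\<close> and \<open>v\<^sub>0\<close>. For \<open>\<chi> = 0\<close> and \<open>\<lambda> \<noteq> 0, -2\<close> the Casimir element acts by a nonzero scalar,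
  which makes every derivation inner; \<open>\<lambda> = 0\<close> gives the trivial module of a perfect Lie algebra.\<close>

section \<open>Derivations of sl(2) on an arbitrary module\<close>

locale sl2_representation = vector_space sc
  for sc :: "'a::field \<Rightarrow> 'm::ab_group_add \<Rightarrow> 'm" +
  fixes V :: "'m set" and act :: "'a sl2 \<Rightarrow> 'm \<Rightarrow> 'm"
  assumes sl2_module: "sl2_module sc V act"
begin

lemma subspace_V: "subspace V"
  using sl2_module by (simp add: sl2_module_def)

lemma act_closed: "m \<in> V \<Longrightarrow> act x m \<in> V"
  using sl2_module by (simp add: sl2_module_def)

lemma act_add: "m \<in> V \<Longrightarrow> n \<in> V \<Longrightarrow> act x (m + n) = act x m + act x n"
  using sl2_module by (simp add: sl2_module_def)

lemma act_scale: "m \<in> V \<Longrightarrow> act x (sc c m) = sc c (act x m)"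
  using sl2_module by (simp add: sl2_module_def)

lemma act_add_left: "m \<in> V \<Longrightarrow> act (x + y) m = act x m + act y m"
  using sl2_module by (simp add: sl2_module_def)

lemma act_scale_left: "m \<in> V \<Longrightarrow> act (sl2_scale c x) m = sc c (act x m)"
  using sl2_module by (simp add: sl2_module_def)

lemma act_bracket: "m \<in> V \<Longrightarrow> act (sl2_bracket x y) m = act x (act y m) - act y (act x m)"
  using sl2_module by (simp add: sl2_module_def)

lemma act_zero: "act x 0 = 0"
  using act_scale[of 0 x 0] subspace_0[OF subspace_V] by simp

lemma act_uminus: "m \<in> V \<Longrightarrow> act x (- m) = - act x m"
  using act_scale[of m x "-1"] by simp

lemma act_diff: "m \<in> V \<Longrightarrow> n \<in> V \<Longrightarrow> act x (m - n) = act x m - act x n"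
  using act_add[of m "- n" x] subspace_neg[OF subspace_V, of n] by (simp add: act_uminus)

lemmas V_closed =
  act_closed subspace_add[OF subspace_V] subspace_diff[OF subspace_V] subspace_neg[OF subspace_V]
  subspace_scale[OF subspace_V] subspace_0[OF subspace_V]

lemma act_he: "m \<in> V \<Longrightarrow> act sl2_h (act sl2_e m) = act sl2_e (act sl2_h m) + sc 2 (act sl2_e m)"
  using act_bracket[of m sl2_h sl2_e] by (simp add: sl2_brackets act_scale_left algebra_simps)

lemma act_hf: "m \<in> V \<Longrightarrow> act sl2_h (act sl2_f m) = act sl2_f (act sl2_h m) - sc 2 (act sl2_f m)"
  using act_bracket[of m sl2_h sl2_f] by (simp add: sl2_brackets act_scale_left algebra_simps)

lemma act_ef: "m \<in> V \<Longrightarrow> act sl2_e (act sl2_f m) = act sl2_f (act sl2_e m) + act sl2_h m"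
  using act_bracket[of m sl2_e sl2_f] by (simp add: sl2_brackets algebra_simps)

lemma linear_inner_der: "m \<in> V \<Longrightarrow> Vector_Spaces.linear sl2_scale sc (inner_der act m)"
  by (simp add: Vector_Spaces.linear_iff vector_space_sl2 vector_space_axioms inner_der_def
      act_add_left act_scale_left)

lemma linear_eq_on_hef:
  assumes "Vector_Spaces.linear sl2_scale sc \<phi>" "Vector_Spaces.linear sl2_scale sc \<psi>"
    and "\<phi> sl2_h = \<psi> sl2_h" "\<phi> sl2_e = \<psi> sl2_e" "\<phi> sl2_f = \<psi> sl2_f"
  shows "\<phi> = \<psi>"
proof
  fix x
  have expand: "\<theta> (sl2_scale a sl2_h + sl2_scale b sl2_e + sl2_scale c sl2_f)
      = sc a (\<theta> sl2_h) + sc b (\<theta> sl2_e) + sc c (\<theta> sl2_f)"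
    if "Vector_Spaces.linear sl2_scale sc \<theta>" for \<theta> a b c
    using that by (simp add: Vector_Spaces.linear_iff)
  show "\<phi> x = \<psi> x"
    using expand[OF assms(1)] expand[OF assms(2)] assms(3-5) sl2_decomp[of x] by metis
qed

lemma Der_linear: "\<phi> \<in> Der sc V act \<Longrightarrow> Vector_Spaces.linear sl2_scale sc \<phi>"
  by (simp add: Der_def)

lemma Der_in_V: "\<phi> \<in> Der sc V act \<Longrightarrow> \<phi> x \<in> V"
  by (auto simp: Der_def)

lemma Der_relations:
  assumes "\<phi> \<in> Der sc V act"
  shows "act sl2_e (\<phi> sl2_h) = act sl2_h (\<phi> sl2_e) - sc 2 (\<phi> sl2_e)"
    and "act sl2_f (\<phi> sl2_h) = act sl2_h (\<phi> sl2_f) + sc 2 (\<phi> sl2_f)"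
    and "\<phi> sl2_h = act sl2_e (\<phi> sl2_f) - act sl2_f (\<phi> sl2_e)"
proof -
  have br: "\<phi> (sl2_bracket x y) = act x (\<phi> y) - act y (\<phi> x)" for x y
    using assms by (simp add: Der_def)
  have sc: "\<phi> (sl2_scale c x) = sc c (\<phi> x)" for c x
    using Der_linear[OF assms] by (simp add: Vector_Spaces.linear_iff)
  show "act sl2_e (\<phi> sl2_h) = act sl2_h (\<phi> sl2_e) - sc 2 (\<phi> sl2_e)"
    "act sl2_f (\<phi> sl2_h) = act sl2_h (\<phi> sl2_f) + sc 2 (\<phi> sl2_f)"
    "\<phi> sl2_h = act sl2_e (\<phi> sl2_f) - act sl2_f (\<phi> sl2_e)"
    using br[of sl2_h sl2_e] br[of sl2_h sl2_f] br[of sl2_e sl2_f]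
    by (simp_all add: sl2_brackets sc algebra_simps)
qed

lemma Der_minus_inner:
  assumes "\<phi> \<in> Der sc V act" "m \<in> V"
  shows "\<phi> - inner_der act m \<in> Der sc V act"
proof -
  have "Vector_Spaces.linear sl2_scale sc (\<phi> - inner_der act m)"
    using Der_linear[OF assms(1)] linear_inner_der[OF assms(2)]
    by (simp add: Vector_Spaces.linear_iff algebra_simps)
  moreover have "(\<phi> - inner_der act m) x \<in> V" for x
    by (simp add: inner_der_def Der_in_V assms V_closed)
  moreover have "\<phi> (sl2_bracket x y) = act x (\<phi> y) - act y (\<phi> x)" for x y
    using assms(1) by (simp add: Der_def)
  ultimately show ?thesis
    using Der_in_V[OF assms(1)] assms(2)
    by (auto simp: Der_def inner_der_def act_diff act_bracket V_closed)
qed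

lemma H1_eq_image:
  assumes S: "S \<subseteq> Der sc V act"
    and cover: "\<And>\<phi>. \<phi> \<in> Der sc V act \<Longrightarrow> \<exists>m\<in>V. \<phi> - inner_der act m \<in> S"
  shows "H1 sc V act = H1_class V act ` S"
proof -
  have "H1_class V act \<phi> = H1_class V act (\<phi> - inner_der act m)" if "m \<in> V" for \<phi> m
  proof -
    have "\<phi> + inner_der act n = (\<phi> - inner_der act m) + inner_der act (m + n)"
      "(\<phi> - inner_der act m) + inner_der act n = \<phi> + inner_der act (n - m)" if "n \<in> V" for n
      using that \<open>m \<in> V\<close> by (simp_all add: fun_eq_iff inner_der_def act_add act_diff)
    then show ?thesis
      using that unfolding H1_class_def Ider_def image_iff by (blast intro: V_closed)
  qed
  then have "H1_class V act \<phi> \<in> H1_class V act ` S" if "\<phi> \<in> Der sc V act" for \<phi>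
    using cover[OF that] by blast
  then show ?thesis using S unfolding H1_def by blast
qed

lemma zero_in_Der: "0 \<in> Der sc V act"
  by (auto simp: Der_def Vector_Spaces.linear_iff vector_space_sl2 vector_space_axioms
      subspace_0[OF subspace_V] act_zero)

lemma H1_trivial:
  assumes "\<And>\<phi>. \<phi> \<in> Der sc V act \<Longrightarrow> \<exists>m\<in>V. \<phi> - inner_der act m = 0"
  shows "H1 sc V act = {H1_class V act 0}"
  using H1_eq_image[of "{0}"] assms zero_in_Der by simp

lemma Der_eq_0:
  assumes "\<phi> \<in> Der sc V act" "\<phi> sl2_h = 0" "\<phi> sl2_e = 0" "\<phi> sl2_f = 0"
  shows "\<phi> = 0"
  using linear_eq_on_hef[OF Der_linear[OF assms(1)] Der_linear[OF zero_in_Der]] assms by simp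

lemma H1_trivial_if_f_bijective:
  assumes surj: "\<And>m. m \<in> V \<Longrightarrow> \<exists>n\<in>V. act sl2_f n = m"
    and inj: "\<And>m. m \<in> V \<Longrightarrow> act sl2_f m = 0 \<Longrightarrow> m = 0"
  shows "H1 sc V act = {H1_class V act 0}"
proof (rule H1_trivial)
  fix \<phi> assume \<phi>: "\<phi> \<in> Der sc V act"
  obtain m where m: "m \<in> V" "act sl2_f m = \<phi> sl2_f" using surj[OF Der_in_V[OF \<phi>]] by blast
  define \<psi> where "\<psi> = \<phi> - inner_der act m"
  have \<psi>: "\<psi> \<in> Der sc V act" unfolding \<psi>_def by (rule Der_minus_inner[OF \<phi> m(1)])
  note R = Der_relations[OF \<psi>]
  have f0: "\<psi> sl2_f = 0" using m by (simp add: \<psi>_def inner_der_def)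
  have h0: "\<psi> sl2_h = 0" by (rule inj[OF Der_in_V[OF \<psi>]]) (simp add: R(2) f0 act_zero)
  have e0: "\<psi> sl2_e = 0" by (rule inj[OF Der_in_V[OF \<psi>]]) (use R(3) in \<open>simp add: f0 h0 act_zero\<close>)
  show "\<exists>m\<in>V. \<phi> - inner_der act m = 0"
    using Der_eq_0[OF \<psi> h0 e0 f0] unfolding \<psi>_def by (rule bexI[OF _ m(1)])
qed

lemma Der_normalise_h:
  assumes \<phi>: "\<phi> \<in> Der sc V act" and surj: "\<And>m. m \<in> V \<Longrightarrow> \<exists>n\<in>V. act sl2_h n = m"
  obtains m \<psi> where "m \<in> V" "\<phi> - inner_der act m = \<psi>" "\<psi> \<in> Der sc V act" "\<psi> sl2_h = 0"
    "act sl2_h (\<psi> sl2_e) = sc 2 (\<psi> sl2_e)" "act sl2_h (\<psi> sl2_f) = sc (- 2) (\<psi> sl2_f)"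
proof -
  obtain m where m: "m \<in> V" "act sl2_h m = \<phi> sl2_h" using surj[OF Der_in_V[OF \<phi>]] by blast
  define \<psi> where "\<psi> = \<phi> - inner_der act m"
  have \<psi>: "\<psi> \<in> Der sc V act" unfolding \<psi>_def by (rule Der_minus_inner[OF \<phi> m(1)])
  have h0: "\<psi> sl2_h = 0" using m by (simp add: \<psi>_def inner_der_def)
  show ?thesis
    using Der_relations(1,2)[OF \<psi>] h0
    by (intro that[of m \<psi>] m(1) \<psi> \<psi>_def[symmetric]) (simp_all add: act_zero eq_neg_iff_add_eq_0)
qed

text \<open>The witness comes from the extension of the trivial module by \<open>V\<close> that is defined by \<open>\<phi>\<close>:
  twice the Casimir element maps the additional basis vector to \<open>2 e \<phi>(f) + 2 f \<phi>(e) + h \<phi>(h)\<close> and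
  commutes with sl(2).\<close>

lemma H1_trivial_if_casimir_nonzero:
  assumes c: "c \<noteq> 0"
    and cas: "\<And>m. m \<in> V \<Longrightarrow> sc 2 (act sl2_e (act sl2_f m) + act sl2_f (act sl2_e m))
      + act sl2_h (act sl2_h m) = sc c m"
  shows "H1 sc V act = {H1_class V act 0}"
proof (rule H1_trivial)
  fix \<phi> assume \<phi>: "\<phi> \<in> Der sc V act"
  define w where "w = sc 2 (act sl2_e (\<phi> sl2_f) + act sl2_f (\<phi> sl2_e)) + act sl2_h (\<phi> sl2_h)"
  note R = Der_relations[OF \<phi>] and In = Der_in_V[OF \<phi>]
  have two: "sc 2 m = m + m" for m using scale_left_distrib[of 1 1 m] by simp
  have w: "w \<in> V" by (simp add: w_def In V_closed)
  have e: "act sl2_e w = sc c (\<phi> sl2_e)"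
  proof -
    have "act sl2_e (\<phi> sl2_h) = act sl2_e (act sl2_e (\<phi> sl2_f)) - act sl2_e (act sl2_f (\<phi> sl2_e))"
      by (subst R(3)) (simp add: act_diff In V_closed)
    then have ee: "act sl2_e (act sl2_e (\<phi> sl2_f)) = act sl2_e (\<phi> sl2_h) + act sl2_e (act sl2_f (\<phi> sl2_e))"
      by simp
    have "act sl2_h (act sl2_e (\<phi> sl2_h)) = act sl2_h (act sl2_h (\<phi> sl2_e) - sc 2 (\<phi> sl2_e))"
      by (simp only: R(1))
    then have eh: "act sl2_e (act sl2_h (\<phi> sl2_h))
        = act sl2_h (act sl2_h (\<phi> sl2_e) - sc 2 (\<phi> sl2_e)) - sc 2 (act sl2_e (\<phi> sl2_h))"
      by (simp add: act_he In eq_diff_eq)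
    show ?thesis
      unfolding cas[OF In, symmetric]
      by (simp add: w_def act_add act_scale In V_closed ee eh R(1) act_diff two act_ef)
  qed
  have f: "act sl2_f w = sc c (\<phi> sl2_f)"
  proof -
    have "act sl2_f (\<phi> sl2_h) = act sl2_f (act sl2_e (\<phi> sl2_f)) - act sl2_f (act sl2_f (\<phi> sl2_e))"
      by (subst R(3)) (simp add: act_diff In V_closed)
    then have ff: "act sl2_f (act sl2_f (\<phi> sl2_e)) = act sl2_f (act sl2_e (\<phi> sl2_f)) - act sl2_f (\<phi> sl2_h)"
      by simp
    have "act sl2_h (act sl2_f (\<phi> sl2_h)) = act sl2_h (act sl2_h (\<phi> sl2_f) + sc 2 (\<phi> sl2_f))"
      by (simp only: R(2))
    then have fh: "act sl2_f (act sl2_h (\<phi> sl2_h))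
        = act sl2_h (act sl2_h (\<phi> sl2_f) + sc 2 (\<phi> sl2_f)) + sc 2 (act sl2_f (\<phi> sl2_h))"
      by (simp add: act_hf In algebra_simps)
    show ?thesis
      unfolding cas[OF In, symmetric]
      by (simp add: w_def act_add act_scale In V_closed ff fh R(2) act_diff two act_ef)
  qed
  have h: "act sl2_h w = sc c (\<phi> sl2_h)"
    unfolding cas[OF In, symmetric] R(1,2)
    by (simp add: w_def act_add act_scale In V_closed act_diff two act_he act_hf)
  have wc: "sc (inverse c) w \<in> V" using w by (simp add: V_closed)
  have "\<phi> - inner_der act (sc (inverse c) w) = 0"
    by (rule Der_eq_0[OF Der_minus_inner[OF \<phi> wc]]) (simp_all add: inner_der_def act_scale w h e f c)
  then show "\<exists>m\<in>V. \<phi> - inner_der act m = 0" by (rule bexI[OF _ wc])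
qed

end

section \<open>The modules L\<open>\<^sub>\<chi>\<close>(\<open>\<lambda>\<close>)\<close>

lemma sl2_representation_L:
  fixes l :: "'a::field"
  assumes "CHAR('a) > 2" and "l \<in> Lambda X"
  shows "sl2_representation L_scale (L_space X l) (L_act X l)"
  using vector_space_L_scale L_is_module[OF assms]
  by (intro sl2_representation.intro sl2_representation_axioms.intro)

lemma of_nat_CHAR_minus_2:
  assumes "CHAR('a::field) > 2"
  shows "of_nat (CHAR('a) - 2) = (- 2 :: 'a)"
  using assms by simp

lemma two_neq_0:
  assumes "CHAR('a::field) > 2"
  shows "(2 :: 'a) \<noteq> 0"
proof -
  have "of_nat 2 \<noteq> (0 :: 'a)"
    unfolding of_nat_eq_0_iff_char_dvd using assms by (auto dest: dvd_imp_le)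
  then show ?thesis by simp
qed

lemma L_h_eigenvector:
  fixes l :: "'a::field"
  assumes p: "CHAR('a) > 2" and m: "m \<in> L_space X l"
    and eig: "L_act X l sl2_h m = L_scale c m"
    and i: "i < L_dim X l \<Longrightarrow> l - 2 * of_nat i \<noteq> c"
  shows "m i = 0"
proof (cases "i < L_dim X l")
  case True
  then have "(l - 2 * of_nat i) * m i = c * m i"
    using fun_cong[OF eig, of i] by (simp add: L_act_coord[OF p m] L_scale_apply)
  then show ?thesis using i[OF True] by simp
qed (use m in \<open>simp add: L_space_def\<close>)

lemma L_h_surj:
  fixes l :: "'a::field"
  assumes p: "CHAR('a) > 2" and m: "m \<in> L_space X l"
    and nz: "\<And>i. i < L_dim X l \<Longrightarrow> l - 2 * of_nat i \<noteq> 0"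
  shows "\<exists>n\<in>L_space X l. L_act X l sl2_h n = m"
proof
  let ?n = "\<lambda>i. m i / (l - 2 * of_nat i)"
  show n: "?n \<in> L_space X l" using m by (simp add: L_space_def)
  show "L_act X l sl2_h ?n = m"
    by (rule ext) (use m nz in \<open>auto simp: L_act_coord[OF p n] L_space_def\<close>)
qed

lemma H1_trivial_chi_f:
  fixes l :: "'a::field"
  assumes p: "CHAR('a) > 2" and l: "l \<in> Lambda X" and f: "X sl2_f \<noteq> 0"
  shows "H1 L_scale (L_space X l) (L_act X l) = {H1_class (L_space X l) (L_act X l) 0}"
proof (rule sl2_representation.H1_trivial_if_f_bijective[OF sl2_representation_L[OF p l]])
  have w: "L_wrap X \<noteq> 0" using f by (simp add: L_wrap_def)
  note n0 = L_dim_pos[OF p, of X l]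
  fix m assume m: "m \<in> L_space X l"
  note C = L_act_coord[OF p]
  show "\<exists>n\<in>L_space X l. L_act X l sl2_f n = m"
  proof
    let ?n = "\<lambda>i. if Suc i = L_dim X l then m 0 / L_wrap X else m (Suc i)"
    show n: "?n \<in> L_space X l" using m by (simp add: L_space_def)
    show "L_act X l sl2_f ?n = m"
      by (rule ext) (use m w n0 in \<open>auto simp: C n L_space_def\<close>)
  qed
  show "m = 0" if "L_act X l sl2_f m = 0"
  proof
    fix i
    have z: "L_act X l sl2_f m j = 0" for j by (simp add: that)
    consider "Suc i = L_dim X l" | "Suc i < L_dim X l" | "L_dim X l \<le> i" by linarith
    then show "m i = 0 i"
    proof cases
      case 1
      then have "L_dim X l - 1 = i" by linarith
      then show ?thesis using z[of 0] w n0 by (simp add: C m)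
    next
      case 2 then show ?thesis using z[of "Suc i"] by (simp add: C m)
    next
      case 3 then show ?thesis using m by (simp add: L_space_def)
    qed
  qed
qed

lemma H1_trivial_chi_h:
  fixes l :: "'a::field"
  assumes p: "CHAR('a) > 2" and l: "l \<in> Lambda X" and h: "X sl2_h \<noteq> 0"
  shows "H1 L_scale (L_space X l) (L_act X l) = {H1_class (L_space X l) (L_act X l) 0}"
proof -
  interpret sl2_representation L_scale "L_space X l" "L_act X l"
    by (rule sl2_representation_L[OF p l])
  have pr: "prime CHAR('a)" using p by (intro prime_CHAR_semidom) auto
  have "l \<noteq> of_nat k" for k
    using l h of_nat_power_CHAR[OF pr, of k] by (auto simp: Lambda_def)
  from this[of "2 * i" for i] this[of "2 * i + 2" for i] this[of "2 * i + (CHAR('a) - 2)" for i]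
  have nz: "l - 2 * of_nat i \<noteq> 0" "l - 2 * of_nat i \<noteq> 2" "l - 2 * of_nat i \<noteq> - 2" for i
    by (auto simp: algebra_simps of_nat_CHAR_minus_2[OF p] simp del: of_nat_diff)
  show ?thesis
  proof (rule H1_trivial)
    fix \<phi> assume \<phi>: "\<phi> \<in> Der L_scale (L_space X l) (L_act X l)"
    obtain m \<psi> where m: "m \<in> L_space X l" and m\<psi>: "\<phi> - inner_der (L_act X l) m = \<psi>"
      and \<psi>: "\<psi> \<in> Der L_scale (L_space X l) (L_act X l)"
      and h0: "\<psi> sl2_h = 0"
      and e: "L_act X l sl2_h (\<psi> sl2_e) = L_scale 2 (\<psi> sl2_e)"
      and f: "L_act X l sl2_h (\<psi> sl2_f) = L_scale (- 2) (\<psi> sl2_f)"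
      using Der_normalise_h[OF \<phi> L_h_surj[OF p]] nz(1) by blast
    have e0: "\<psi> sl2_e = 0"
      by (rule ext) (simp only: L_h_eigenvector[OF p Der_in_V[OF \<psi>] e nz(2)] zero_fun_apply)
    have f0: "\<psi> sl2_f = 0"
      by (rule ext) (simp only: L_h_eigenvector[OF p Der_in_V[OF \<psi>] f nz(3)] zero_fun_apply)
    show "\<exists>m\<in>L_space X l. \<phi> - inner_der (L_act X l) m = 0"
      using Der_eq_0[OF \<psi> h0 e0 f0] m\<psi> by (intro bexI[OF _ m]) simp
  qed
qed

lemma H1_trivial_restricted:
  fixes l :: "'a::field"
  assumes p: "CHAR('a) > 2" and l: "l \<in> Lambda X"
    and X: "X sl2_h = 0" "X sl2_f = 0" and l0: "l \<noteq> 0" and l2: "l \<noteq> - 2"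
  shows "H1 L_scale (L_space X l) (L_act X l) = {H1_class (L_space X l) (L_act X l) 0}"
proof (rule sl2_representation.H1_trivial_if_casimir_nonzero[OF sl2_representation_L[OF p l]])
  have "l + 2 \<noteq> 0" using l2 by (simp add: eq_neg_iff_add_eq_0)
  then show "l * (l + 2) \<noteq> 0" using l0 by simp
  fix m assume m: "m \<in> L_space X l"
  have w: "L_wrap X = 0" using X by (simp add: L_wrap_def)
  have ln: "l = of_nat (L_dim X l - 1)"
    by (rule L_cases[OF p l]) (use X in auto)
  note C = L_act_coord[OF p]
  let ?C = "L_scale 2 (L_act X l sl2_e (L_act X l sl2_f m) + L_act X l sl2_f (L_act X l sl2_e m))
      + L_act X l sl2_h (L_act X l sl2_h m)"
  show "?C = L_scale (l * (l + 2)) m"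
  proof
    fix j
    have e: "L_act X l sl2_e (L_act X l sl2_f m) j = of_nat (j + 1) * (l - of_nat j) * m j"
      if "j < L_dim X l"
    proof -
      have 1: "L_act X l sl2_e (L_act X l sl2_f m) j
          = of_nat (j + 1) * (l - of_nat j) * L_act X l sl2_f m (j + 1)"
        using that by (simp add: C[OF L_act_space[OF p m]])
      show ?thesis
      proof (cases "j + 1 < L_dim X l")
        case True
        then show ?thesis unfolding 1 by (simp add: C[OF m])
      next
        case False
        then have "L_dim X l - 1 = j" using that by linarith
        then have "l - of_nat j = 0" using ln by simp
        then show ?thesis unfolding 1 by (simp only: mult_zero_left mult_zero_right)
      qed
    qed
    have f: "L_act X l sl2_f (L_act X l sl2_e m) j = of_nat j * (l - of_nat j + 1) * m j"
      if "j < L_dim X l"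
      using that by (cases j) (simp_all add: C m L_act_space[OF p m] w)
    show "?C j = L_scale (l * (l + 2)) m j"
    proof (cases "j < L_dim X l")
      case True
      then show ?thesis
        by (simp add: e f L_scale_apply) (simp add: C m L_act_space[OF p m] algebra_simps)
    next
      case False
      then show ?thesis
        using m by (simp add: C L_act_space[OF p m] L_scale_apply, simp add: L_space_def C)
    qed
  qed
qed

lemma H1_trivial_one_dim:
  fixes l :: "'a::field"
  assumes p: "CHAR('a) > 2" and l: "l \<in> Lambda X"
    and X: "X sl2_h = 0" "X sl2_f = 0" and l0: "l = 0"
  shows "H1 L_scale (L_space X l) (L_act X l) = {H1_class (L_space X l) (L_act X l) 0}"
proof -
  interpret sl2_representation L_scale "L_space X l" "L_act X l"
    by (rule sl2_representation_L[OF p l])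
  have n: "L_dim X l = 1"
  proof (rule L_cases[OF p l])
    assume ln: "l = of_nat (L_dim X l - 1)" and "L_dim X l \<le> CHAR('a)"
    have "L_dim X l - 1 = 0"
      by (rule of_nat_inj_CHAR[where 'a = 'a])
        (use ln l0 p \<open>L_dim X l \<le> CHAR('a)\<close> in \<open>auto simp del: of_nat_diff\<close>)
    then show ?thesis using L_dim_pos[OF p, of X l] by linarith
  qed (use X in auto)
  have triv: "L_act X l x m = 0" if "m \<in> L_space X l" for x m
    by (rule ext) (simp add: L_act_coord[OF p that] n L_wrap_def X, simp add: l0)
  show ?thesis
  proof (rule H1_trivial)
    fix \<phi> assume \<phi>: "\<phi> \<in> Der L_scale (L_space X l) (L_act X l)"
    note R = Der_relations[OF \<phi>, unfolded triv[OF Der_in_V[OF \<phi>]]]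
    have "\<phi> = 0"
      by (rule Der_eq_0[OF \<phi>]) (use R two_neq_0[OF p] in \<open>simp_all\<close>)
    then show "\<exists>m\<in>L_space X l. \<phi> - inner_der (L_act X l) m = 0"
      by (intro bexI[OF _ subspace_0[OF subspace_V]]) (simp add: inner_der_def fun_eq_iff act_zero)
  qed
qed

lemma H1_nontrivial:
  fixes l :: "'a::field"
  assumes p: "CHAR('a) > 2" and l: "l \<in> Lambda X"
    and X: "X sl2_h = 0" "X sl2_f = 0" and l2: "l = of_nat (CHAR('a) - 2)"
  shows "H1 L_scale (L_space X l) (L_act X l) =
    {H1_class (L_space X l) (L_act X l) (\<lambda>x. L_scale a (d1 x) + L_scale b (d2 x)) | a b. True}"
proof -
  interpret sl2_representation L_scale "L_space X l" "L_act X l"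
    by (rule sl2_representation_L[OF p l])
  have w: "L_wrap X = 0" using X by (simp add: L_wrap_def)
  have lm: "l = - 2" using l2 of_nat_CHAR_minus_2[OF p] by simp
  have n: "L_dim X l = CHAR('a) - 1"
  proof (rule L_cases[OF p l])
    assume ln: "l = of_nat (L_dim X l - 1)" and "L_dim X l \<le> CHAR('a)"
    have "L_dim X l - 1 = CHAR('a) - 2"
      by (rule of_nat_inj_CHAR[where 'a = 'a])
        (use ln[symmetric] l2 p \<open>L_dim X l \<le> CHAR('a)\<close> in \<open>auto simp del: of_nat_diff\<close>)
    then show ?thesis using L_dim_pos[OF p, of X l] p by linarith
  qed (use X in auto)
  note C = L_act_coord[OF p]
  define D :: "'a \<Rightarrow> 'a \<Rightarrow> 'a sl2 \<Rightarrow> nat \<Rightarrow> 'a"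
    where "D a b = (\<lambda>x. L_scale a (d1 x) + L_scale b (d2 x))" for a b
  have D_apply: "D a b x i = (if i = CHAR('a) - 2 then a * mat_of x $ 1 $ 2 else 0)
      + (if i = 0 then b * mat_of x $ 2 $ 1 else 0)" for a b x i
    by (simp add: D_def d1_def d2_def L_scale_apply L_basis_def)
  have D_linear: "Vector_Spaces.linear sl2_scale L_scale (D a b)" for a b
    by (simp add: Vector_Spaces.linear_iff vector_space_sl2 vector_space_axioms fun_eq_iff D_apply
        L_scale_apply algebra_simps)
  have D_V: "D a b x \<in> L_space X l" for a b x
    using p by (auto simp: L_space_def n D_apply)
  obtain k where k: "CHAR('a) = k + 3" using p less_eqE[of 3 "CHAR('a)"] by (auto simp: add.commute)
  have k0: "of_nat k = (- 3 :: 'a)"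
    using of_nat_CHAR[where 'a = 'a] by (simp add: k eq_neg_iff_add_eq_0)
  have D_Der: "D a b \<in> Der L_scale (L_space X l) (L_act X l)" for a b
  proof -
    have "D a b (sl2_bracket x y) i = (L_act X l x (D a b y) - L_act X l y (D a b x)) i" for x y i
    proof -
      consider "i > k + 1" | "i = 0" | "i \<noteq> 0" "i = k + 1" | "i \<noteq> 0" "i = k" | "i \<noteq> 0" "i < k"
        by linarith
      then show ?thesis
        by cases (simp add: C D_V n w k; auto simp: k0 lm D_apply k mat_of_bracket algebra_simps)+
    qed
    then show ?thesis using D_linear D_V by (auto simp: Der_def fun_eq_iff)
  qed
  have nz: "l - 2 * of_nat i \<noteq> 0" if i: "i < L_dim X l" for i
  proof
    assume "l - 2 * of_nat i = 0"
    then have "2 * of_nat (i + 1) = (0 :: 'a)" by (simp add: lm algebra_simps eq_neg_iff_add_eq_0)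
    then have "of_nat (i + 1) = (0 :: 'a)" using two_neq_0[OF p] by (simp only: mult_eq_0_iff simp_thms)
    then have "CHAR('a) dvd i + 1" unfolding of_nat_eq_0_iff_char_dvd .
    then show False using i n by (auto dest: dvd_imp_le)
  qed
  have nz2: "l - 2 * of_nat i \<noteq> 2" if i: "i < L_dim X l" "i \<noteq> CHAR('a) - 2" for i
  proof
    assume "l - 2 * of_nat i = 2"
    then have "l - 2 * of_nat (i + 1) = 0" by (simp add: algebra_simps)
    moreover have "i + 1 < L_dim X l" using i unfolding n by linarith
    ultimately show False using nz by blast
  qed
  have nzm2: "l - 2 * of_nat i \<noteq> - 2" if i: "i < L_dim X l" "i \<noteq> 0" for i
    using nz[of "i - 1"] i by (cases i) (auto simp: algebra_simps)
  have "H1 L_scale (L_space X l) (L_act X l)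
      = H1_class (L_space X l) (L_act X l) ` {D a b | a b. True}"
  proof (rule H1_eq_image)
    fix \<phi> assume \<phi>: "\<phi> \<in> Der L_scale (L_space X l) (L_act X l)"
    obtain m \<psi> where m: "m \<in> L_space X l" and m\<psi>: "\<phi> - inner_der (L_act X l) m = \<psi>"
      and \<psi>: "\<psi> \<in> Der L_scale (L_space X l) (L_act X l)"
      and h0: "\<psi> sl2_h = 0"
      and e: "L_act X l sl2_h (\<psi> sl2_e) = L_scale 2 (\<psi> sl2_e)"
      and f: "L_act X l sl2_h (\<psi> sl2_f) = L_scale (- 2) (\<psi> sl2_f)"
      using Der_normalise_h[OF \<phi> L_h_surj[OF p]] nz by blast
    have e0: "\<psi> sl2_e i = 0" if "i \<noteq> CHAR('a) - 2" for i
      using L_h_eigenvector[OF p Der_in_V[OF \<psi>] e nz2] that by blast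
    have f0: "\<psi> sl2_f i = 0" if "i \<noteq> 0" for i
      using L_h_eigenvector[OF p Der_in_V[OF \<psi>] f nzm2] that by blast
    let ?a = "\<psi> sl2_e (CHAR('a) - 2)" and ?b = "\<psi> sl2_f 0"
    have "\<psi> = D ?a ?b"
    proof (rule linear_eq_on_hef[OF Der_linear[OF \<psi>] D_linear])
      show "\<psi> sl2_h = D ?a ?b sl2_h" unfolding h0 by (simp add: fun_eq_iff D_apply)
      show "\<psi> sl2_e = D ?a ?b sl2_e" "\<psi> sl2_f = D ?a ?b sl2_f"
        using e0 f0 by (simp_all only: fun_eq_iff D_apply mat_of_simps) simp_all
    qed
    then show "\<exists>m\<in>L_space X l. \<phi> - inner_der (L_act X l) m \<in> {D a b | a b. True}"
      using m m\<psi> by blast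
  qed (use D_Der in blast)
  also have "\<dots> = {H1_class (L_space X l) (L_act X l) (D a b) | a b. True}" by blast
  finally show ?thesis unfolding D_def .
qed

theorem theorem2p1:
  fixes chi :: "'a::field sl2 \<Rightarrow> 'a" and l :: 'a
  assumes "CHAR('a) > 2"
    and "Vector_Spaces.linear sl2_scale (*) chi"
    and "chi sl2_e = 0"
    and "l \<in> Lambda chi"
  shows "H1 L_scale (L_space chi l) (L_act chi l) =
    (if chi = 0 \<and> l = of_nat (CHAR('a) - 2)
     then {H1_class (L_space chi l) (L_act chi l) (\<lambda>x. L_scale a (d1 x) + L_scale b (d2 x)) | a b. True}
     else {H1_class (L_space chi l) (L_act chi l) 0})"
proof (cases "chi sl2_h = 0 \<and> chi sl2_f = 0")
  case True
  have "chi x = 0" for x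
    using assms(2,3) True by (subst sl2_decomp[of x]) (simp only: Vector_Spaces.linear_iff, simp)
  then have "chi = 0" by (simp add: fun_eq_iff)
  then show ?thesis
    using True H1_nontrivial[OF assms(1,4)] H1_trivial_one_dim[OF assms(1,4)]
      H1_trivial_restricted[OF assms(1,4)] of_nat_CHAR_minus_2[OF assms(1)]
    by (cases "l = of_nat (CHAR('a) - 2)"; cases "l = 0") (simp_all del: of_nat_diff)
next
  case False
  then have "chi \<noteq> 0" by auto
  then show ?thesis
    using False H1_trivial_chi_h[OF assms(1,4)] H1_trivial_chi_f[OF assms(1,4)] by auto
qed

end
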